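(* Let $G$ be a finite group. The following are equivalent. (1) $G$ is nilpotent. (2) For each subgroup $H \leq G$ and for all $x \in G$, $x^{[G:H]} \in H$. (3) For each Sylow subgroup $P$ of $G$ and for all $x \in G$, $x^{[G:P]} \in P$.
   Context: For a subgroup $H \leq G$, $[G:H]$ denotes the index of $H$ in $G$. A group $G$ is nilpotent if its upper central series $Z_0 \trianglelefteq Z_1 \trianglelefteq Z_2 \trianglelefteq \cdots$ terminates at $G$ in a finite number of steps, where $Z_0$ is the trivial subgroup, $Z_1$ is the center of $G$, and $Z_{i+1}$ is chosen so that $Z_{i+1}/Z_i$ equals the center of $G/Z_i$. *)

theory Defs
  imports "HOL-Algebra.Sylow"
begin

definition group_center :: "('a, 'b) monoid_scheme \<Rightarrow> 'a set" where
  "group_center G = {z \<in> carrier G. \<forall>x \<in> carrier G. z \<otimes>\<^bsub>G\<^esub> x = x \<otimes>\<^bsub>G\<^esub> z}"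

(* Z (i + 1) is the preimage of the centre of G / Z i under the quotient map;
   upper_central_series_quotient below is the usual formulation. *)
primrec upper_central_series :: "('a, 'b) monoid_scheme \<Rightarrow> nat \<Rightarrow> 'a set" where
  "upper_central_series G 0 = {\<one>\<^bsub>G\<^esub>}"
| "upper_central_series G (Suc i) =
    {x \<in> carrier G. upper_central_series G i #>\<^bsub>G\<^esub> x
        \<in> group_center (G Mod upper_central_series G i)}"

definition nilpotent_group :: "('a, 'b) monoid_scheme \<Rightarrow> bool" where
  "nilpotent_group G \<longleftrightarrow> group G \<and> (\<exists>n. upper_central_series G n = carrier G)"

(* Primes not dividing the order are allowed; the Sylow p-subgroup is then trivial.
   Meaningful for finite G only. *)
definition sylow_subgroup :: "nat \<Rightarrow> 'a set \<Rightarrow> ('a, 'b) monoid_scheme \<Rightarrow> bool" where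
  "sylow_subgroup p P G \<longleftrightarrow>
     prime p \<and> subgroup P G \<and> card P = p ^ multiplicity p (order G)"

definition subgroup_index :: "('a, 'b) monoid_scheme \<Rightarrow> 'a set \<Rightarrow> nat" where
  "subgroup_index G H = card (rcosets\<^bsub>G\<^esub> H)"

context group
begin

lemma preimage_center_normal:
  assumes N: "N \<lhd> G"
  shows "{x \<in> carrier G. N #> x \<in> group_center (G Mod N)} \<lhd> G"
proof -
  interpret N: normal N G by (rule N)
  let ?Z = "{x \<in> carrier G. N #> x \<in> group_center (G Mod N)}"
  have iff: "x \<in> ?Z \<longleftrightarrow> x \<in> carrier G \<and> (\<forall>y \<in> carrier G. N #> (x \<otimes> y) = N #> (y \<otimes> x))" for x
    by (auto simp: group_center_def carrier_FactGroup N.rcos_sum)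
  have sub: "subgroup ?Z G"
  proof (rule subgroupI)
    show "?Z \<subseteq> carrier G" by blast
    have "\<one> \<in> ?Z" unfolding iff by simp
    then show "?Z \<noteq> {}" by blast
  next
    fix a assume a: "a \<in> ?Z"
    then have aG: "a \<in> carrier G" by simp
    have "N #> (inv a \<otimes> y) = N #> (y \<otimes> inv a)" if y: "y \<in> carrier G" for y
    proof -
      have "N #> (a \<otimes> (inv a \<otimes> y \<otimes> inv a)) = N #> ((inv a \<otimes> y \<otimes> inv a) \<otimes> a)"
        using a y unfolding iff by simp
      moreover have "a \<otimes> (inv a \<otimes> y \<otimes> inv a) = y \<otimes> inv a"
        using aG y by (metis inv_closed m_assoc m_closed r_inv l_one)
      moreover have "(inv a \<otimes> y \<otimes> inv a) \<otimes> a = inv a \<otimes> y"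
        using aG y by (simp add: m_assoc)
      ultimately show ?thesis by simp
    qed
    then show "inv a \<in> ?Z" using aG unfolding iff by simp
  next
    fix a b assume a: "a \<in> ?Z" and b: "b \<in> ?Z"
    then have aG: "a \<in> carrier G" and bG: "b \<in> carrier G" by simp_all
    have "N #> (a \<otimes> b \<otimes> y) = N #> (y \<otimes> (a \<otimes> b))" if y: "y \<in> carrier G" for y
    proof -
      have "N #> (a \<otimes> b \<otimes> y) = (N #> a) <#> (N #> (b \<otimes> y))"
        using aG bG y by (simp add: N.rcos_sum m_assoc)
      also have "\<dots> = (N #> a) <#> (N #> (y \<otimes> b))" using b y unfolding iff by simp
      also have "\<dots> = (N #> (a \<otimes> y)) <#> (N #> b)"
        using aG bG y by (simp add: N.rcos_sum m_assoc)
      also have "\<dots> = (N #> (y \<otimes> a)) <#> (N #> b)" using a y unfolding iff by simp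
      also have "\<dots> = N #> (y \<otimes> (a \<otimes> b))" using aG bG y by (simp add: N.rcos_sum m_assoc)
      finally show ?thesis .
    qed
    then show "a \<otimes> b \<in> ?Z" using aG bG unfolding iff by simp
  qed
  show ?thesis
  proof (rule normal_invI[OF sub])
    fix x h assume x: "x \<in> carrier G" and h: "h \<in> ?Z"
    then have hG: "h \<in> carrier G" by simp
    have "N #> (x \<otimes> h \<otimes> inv x) = (N #> (x \<otimes> h)) <#> (N #> inv x)"
      using x hG by (simp add: N.rcos_sum)
    also have "\<dots> = (N #> (h \<otimes> x)) <#> (N #> inv x)" using x h unfolding iff by simp
    also have "\<dots> = N #> h" using x hG by (simp add: N.rcos_sum m_assoc)
    finally show "x \<otimes> h \<otimes> inv x \<in> ?Z" using x h by simp
  qed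
qed

lemma upper_central_series_normal: "upper_central_series G i \<lhd> G"
proof (induction i)
  case 0
  show ?case by (simp add: one_is_normal)
next
  case (Suc i)
  then show ?case using preimage_center_normal by simp
qed

lemma upper_central_series_mono: "upper_central_series G i \<subseteq> upper_central_series G (Suc i)"
proof
  fix x assume x: "x \<in> upper_central_series G i"
  interpret N: normal "upper_central_series G i" G by (rule upper_central_series_normal)
  have "upper_central_series G i #> x = \<one>\<^bsub>G Mod upper_central_series G i\<^esub>"
    using x by (simp add: N.rcos_const[OF is_group] FactGroup_def)
  moreover have "\<one>\<^bsub>G Mod upper_central_series G i\<^esub> \<in> group_center (G Mod upper_central_series G i)"
  proof -
    interpret Q: group "G Mod upper_central_series G i" by (rule N.factorgroup_is_group)
    show ?thesis unfolding group_center_def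
      using Q.one_closed Q.l_one Q.r_one by (simp del: one_FactGroup mult_FactGroup)
  qed
  ultimately show "x \<in> upper_central_series G (Suc i)" using x N.subset by auto
qed

lemma upper_central_series_quotient:
  "carrier ((G\<lparr>carrier := upper_central_series G (Suc i)\<rparr>) Mod upper_central_series G i)
     = group_center (G Mod upper_central_series G i)"
  by (auto simp: carrier_FactGroup group_center_def r_coset_def)

lemma upper_central_series_1: "upper_central_series G 1 = group_center G"
proof -
  have "{\<one>} #> x = {x}" if "x \<in> carrier G" for x
    using that by (simp add: r_coset_def)
  moreover have "{x} <#> {y} = {x \<otimes> y}" for x y
    by (simp add: set_mult_def)
  ultimately show ?thesis
    by (auto simp: group_center_def carrier_FactGroup)
qed

end

end

theory Submission
  imports Defs "HOL-Algebra.Zassenhaus" "HOL-Algebra.Multiplicative_Group"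
begin

text \<open>
  (1) implies (2): in a nilpotent group every proper subgroup \<open>H\<close> is strictly contained in its
  normalizer \<open>K\<close>. As \<open>H\<close> is normal in \<open>K\<close>, raising to the power \<open>[K:H]\<close> maps \<open>K\<close>
  into \<open>H\<close>, so the claim follows from \<open>[G:H] = [G:K] [K:H]\<close> by induction on the index.

  (3) implies (1): if \<open>x\<close> has \<open>p\<close>-power order and its \<open>[G:P]\<close>-th power lies in the Sylow
  \<open>p\<close>-subgroup \<open>P\<close>, then \<open>x \<in> P\<close>, because \<open>p\<close> does not divide \<open>[G:P]\<close>. So \<open>P\<close> consists of all
  \<open>p\<close>-elements and is normal, and Sylow subgroups for different primes centralize each other.
  Given a proper normal subgroup \<open>N\<close>, choose a Sylow subgroup \<open>P\<close> not contained in \<open>N\<close>. A nontrivial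
  central element of the \<open>p\<close>-group \<open>PN/N\<close> then commutes in \<open>G/N\<close> with the image of every Sylow
  subgroup, hence is central, so the upper central series keeps growing until it reaches \<open>G\<close>.
\<close>

context group
begin

section \<open>Powers of elements and indices of subgroups\<close>

lemma subgroup_nat_pow_closed:
  assumes "subgroup H G" "x \<in> H"
  shows "x [^] (n::nat) \<in> H"
  using assms by (induction n) (auto simp: subgroup.one_closed subgroup.m_closed)

lemma pow_card_subgroup_eq_one:
  assumes H: "subgroup H G" and x: "x \<in> H"
  shows "x [^] card H = \<one>"
proof -
  interpret K: group "G\<lparr>carrier := H\<rparr>" by (rule subgroup_imp_group[OF H])
  show ?thesis
    using K.pow_order_eq_1[of x] x by (simp add: order_def nat_pow_consistent[symmetric])
qed

text \<open>Bezout's identity writes \<open>x\<close> as a product of powers of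
  \<open>x [^] a\<close> and \<open>x [^] b\<close>, one of them inverted.\<close>

lemma mem_subgroup_if_coprime_pows:
  assumes H: "subgroup H G" and x: "x \<in> carrier G"
    and a: "x [^] (a::nat) \<in> H" and b: "x [^] (b::nat) \<in> H" and ab: "coprime a b"
  shows "x \<in> H"
proof (cases "a = 0")
  \<comment> \<open>Bezout over the naturals, \<open>a * u = b * v + 1\<close>, needs
    \<open>a\<close> nonzero, so this case is split off.\<close>
  case True
  then have "b = 1" using ab by simp
  then show ?thesis using b x by simp
next
  case False
  then obtain u v where uv: "a * u = b * v + 1"
    using bezout_nat[of a b] ab by auto
  have "x [^] (a * u) \<in> H" "x [^] (b * v) \<in> H"
    using subgroup_nat_pow_closed[OF H a, of u] subgroup_nat_pow_closed[OF H b, of v] x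
    by (simp_all add: nat_pow_pow)
  then have "inv (x [^] (b * v)) \<otimes> x [^] (a * u) \<in> H"
    using H by (simp add: subgroup.m_closed subgroup.m_inv_closed)
  moreover have "x [^] (a * u) = x [^] (b * v) \<otimes> x" unfolding uv by simp
  then have "x = inv (x [^] (b * v)) \<otimes> x [^] (a * u)"
    using x by (simp add: inv_solve_left)
  ultimately show ?thesis by simp
qed

lemma index_mult_card:
  assumes "subgroup H G"
  shows "subgroup_index G H * card H = order G"
  using lagrange[OF assms] by (simp add: subgroup_index_def)

text \<open>The index is the order of the quotient group, in which that power of the coset of
  \<open>x\<close> is trivial.\<close>

lemma pow_index_mem_normal:
  assumes "N \<lhd> G" and x: "x \<in> carrier G"
  shows "x [^] subgroup_index G N \<in> N"
proof -
  interpret N: normal N G by (rule assms(1))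
  interpret Q: group "G Mod N" by (rule N.factorgroup_is_group)
  have "N #> x \<in> carrier (G Mod N)" using x by (auto simp: carrier_FactGroup)
  then have "(N #> x) [^]\<^bsub>G Mod N\<^esub> order (G Mod N) = N" using Q.pow_order_eq_1 by fastforce
  moreover have "order (G Mod N) = subgroup_index G N"
    by (simp add: order_def subgroup_index_def FactGroup_def)
  ultimately have "N #> (x [^] subgroup_index G N) = N" using x by (simp add: N.FactGroup_pow)
  then show ?thesis using rcos_self[OF _ N.subgroup_axioms] x by (metis nat_pow_closed)
qed

text \<open>Since \<open>[G:H] = [G:K] [K:H]\<close>, the power can be taken in two stages: the
  first lands in \<open>K\<close>, the second in \<open>H\<close> by normality of \<open>H\<close>
  in \<open>K\<close>. Normality of \<open>H\<close> in \<open>G\<close> is not assumed.\<close>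

lemma pow_index_mem_trans:
  assumes fin: "finite (carrier G)" and K: "subgroup K G" and H: "H \<lhd> G\<lparr>carrier := K\<rparr>"
    and xG: "x \<in> carrier G" and x: "x [^] subgroup_index G K \<in> K"
  shows "x [^] subgroup_index G H \<in> H"
proof -
  let ?K = "G\<lparr>carrier := K\<rparr>"
  interpret K: group ?K by (rule subgroup_imp_group[OF K])
  have HK: "subgroup H ?K" using H by (rule normal_imp_subgroup)
  have HG: "subgroup H G" using incl_subgroup[OF K HK] .
  have "subgroup_index ?K H * card H = card K"
    using K.index_mult_card[OF HK] by (simp add: order_def)
  then have "subgroup_index G H * card H = (subgroup_index G K * subgroup_index ?K H) * card H"
    using index_mult_card[OF K] index_mult_card[OF HG] by (simp add: mult.assoc)
  moreover have "card H > 0"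
    using HG fin by (simp add: subgroup.finite_imp_card_positive)
  ultimately have "subgroup_index G H = subgroup_index G K * subgroup_index ?K H" by simp
  moreover have "(x [^] subgroup_index G K) [^] subgroup_index ?K H \<in> H"
    using K.pow_index_mem_normal[OF H, of "x [^] subgroup_index G K"] x
    by (simp add: nat_pow_consistent[symmetric])
  ultimately show ?thesis using xG by (simp add: nat_pow_pow)
qed

section \<open>Nilpotent groups: normalizers grow\<close>

lemma mem_upper_central_series_Suc:
  "x \<in> upper_central_series G (Suc i) \<longleftrightarrow> x \<in> carrier G \<and>
     (\<forall>y \<in> carrier G. upper_central_series G i #> (x \<otimes> y) = upper_central_series G i #> (y \<otimes> x))"
proof -
  interpret N: normal "upper_central_series G i" G by (rule upper_central_series_normal)
  show ?thesis by (auto simp: group_center_def carrier_FactGroup N.rcos_sum)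
qed

text \<open>As \<open>z\<close> is central modulo the \<open>i\<close>-th term,
  \<open>z \<otimes> h = n \<otimes> h \<otimes> z\<close> for some \<open>n\<close> in that term,
  so the conjugate is \<open>n \<otimes> h\<close>, a product of elements of
  \<open>H\<close>.\<close>

lemma upper_central_series_Suc_conj_mem:
  assumes H: "subgroup H G" and sub: "upper_central_series G i \<subseteq> H"
    and z: "z \<in> upper_central_series G (Suc i)" and h: "h \<in> H"
  shows "z \<otimes> h \<otimes> inv z \<in> H"
proof -
  interpret N: normal "upper_central_series G i" G by (rule upper_central_series_normal)
  have zG: "z \<in> carrier G" and hG: "h \<in> carrier G"
    using z h subgroup.mem_carrier[OF H] by (simp_all add: mem_upper_central_series_Suc)
  have "z \<otimes> h \<in> upper_central_series G i #> (h \<otimes> z)"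
    using z rcos_self[of "z \<otimes> h", OF _ N.subgroup_axioms] zG hG
    by (metis m_closed mem_upper_central_series_Suc)
  then obtain n where n: "n \<in> upper_central_series G i" "z \<otimes> h = n \<otimes> (h \<otimes> z)"
    by (auto simp: r_coset_def)
  then have "z \<otimes> h \<otimes> inv z = n \<otimes> h"
    using zG hG N.subset by (simp add: m_assoc subset_iff)
  then show ?thesis using n sub h subgroup.m_closed[OF H] by auto
qed

text \<open>The normalizer is a stabilizer under conjugation of subsets, so it asks for an equality
  of sets; conjugation by \<open>inv z\<close> supplies the reverse inclusion.\<close>

lemma mem_normalizerI:
  assumes H: "subgroup H G" and z: "z \<in> carrier G"
    and 1: "\<And>h. h \<in> H \<Longrightarrow> z \<otimes> h \<otimes> inv z \<in> H"
    and 2: "\<And>h. h \<in> H \<Longrightarrow> inv z \<otimes> h \<otimes> z \<in> H"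
  shows "z \<in> normalizer G H"
proof -
  have HG: "H \<subseteq> carrier G" using H by (rule subgroup.subset)
  have "z <# H #> inv z = H"
  proof
    show "z <# H #> inv z \<subseteq> H" using 1 by (auto simp: l_coset_def r_coset_def)
    show "H \<subseteq> z <# H #> inv z"
    proof
      fix h assume h: "h \<in> H"
      then have "h = z \<otimes> (inv z \<otimes> h \<otimes> z) \<otimes> inv z"
        using conjugation_is_surj[OF z, of h] HG by auto
      then show "h \<in> z <# H #> inv z"
        using 2[OF h] unfolding l_coset_def r_coset_def by blast
    qed
  qed
  then show ?thesis using z HG by (simp add: normalizer_def stabilizer_def)
qed

text \<open>The upper central series starts inside \<open>H\<close> and ends outside it. Where it
  first leaves \<open>H\<close>, every element of the new term normalizes \<open>H\<close>, and one
  of them lies outside \<open>H\<close>.\<close>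

lemma nilpotent_proper_subgroup_normalizer:
  assumes nil: "nilpotent_group G" and H: "subgroup H G" and ne: "H \<noteq> carrier G"
  shows "H \<subset> normalizer G H"
proof -
  have HN: "H \<subseteq> normalizer G H"
    using normal_imp_subgroup[OF subgroup_in_normalizer[OF H]] subgroup.subset by fastforce
  obtain n where n: "upper_central_series G n = carrier G"
    using nil by (auto simp: nilpotent_group_def)
  have "\<not> upper_central_series G n \<subseteq> H" using n ne subgroup.subset[OF H] by auto
  moreover have "upper_central_series G 0 \<subseteq> H" using subgroup.one_closed[OF H] by simp
  ultimately obtain i where i: "upper_central_series G i \<subseteq> H" "\<not> upper_central_series G (Suc i) \<subseteq> H"
    using nat_induct[of "\<lambda>i. upper_central_series G i \<subseteq> H" n]
    by (auto simp del: upper_central_series.simps)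
  then obtain z where z: "z \<in> upper_central_series G (Suc i)" "z \<notin> H" by blast
  interpret Z: normal "upper_central_series G (Suc i)" G by (rule upper_central_series_normal)
  have zG: "z \<in> carrier G" using z Z.subset by blast
  have "z \<in> normalizer G H"
  proof (rule mem_normalizerI[OF H zG])
    fix h assume h: "h \<in> H"
    show "z \<otimes> h \<otimes> inv z \<in> H"
      using upper_central_series_Suc_conj_mem[OF H i(1) z(1) h] .
    show "inv z \<otimes> h \<otimes> z \<in> H"
      using upper_central_series_Suc_conj_mem[OF H i(1) Z.m_inv_closed[OF z(1)] h]
      unfolding inv_inv[OF zG] .
  qed
  then show ?thesis using HN z by blast
qed

text \<open>Replacing a proper subgroup \<open>H\<close> by its strictly larger normalizer lowers
  \<open>order G - card H\<close>, the measure of the induction; \<open>pow_index_mem_trans\<close>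
  then leads back to \<open>H\<close>.\<close>

lemma nilpotent_imp_pow_index_mem:
  assumes nil: "nilpotent_group G" and fin: "finite (carrier G)"
    and "subgroup H G" and x: "x \<in> carrier G"
  shows "x [^] subgroup_index G H \<in> H"
  using assms(3)
proof (induction "order G - card H" arbitrary: H rule: less_induct)
  case less
  note H = less.prems
  show ?case
  proof (cases "H = carrier G")
    case True
    then show ?thesis using x by simp
  next
    case False
    let ?K = "normalizer G H"
    have K: "subgroup ?K G" using normalizer_imp_subgroup subgroup.subset[OF H] by blast
    have "card H < card ?K"
      using nilpotent_proper_subgroup_normalizer[OF nil H False] subgroup.subset[OF K] fin
      by (meson psubset_card_mono finite_subset)
    moreover have "card ?K \<le> order G"
      using subgroup.subset[OF K] fin by (simp add: order_def card_mono)
    ultimately have "x [^] subgroup_index G ?K \<in> ?K"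
      by (intro less.hyps[OF _ K]) linarith
    then show ?thesis
      using pow_index_mem_trans[OF fin K subgroup_in_normalizer[OF H]] x by blast
  qed
qed

section \<open>Sylow subgroups and centres of groups of prime power order\<close>

lemma sylow_subgroup_exists:
  assumes fin: "finite (carrier G)" and p: "prime p"
  shows "\<exists>P. sylow_subgroup p P G"
proof -
  obtain m where "order G = p ^ multiplicity p (order G) * m"
    using multiplicity_dvd[of p "order G"] by (rule dvdE)
  then show ?thesis
    using sylow_thm[OF p is_group _ fin] p unfolding sylow_subgroup_def by blast
qed

text \<open>By Lagrange, \<open>card K\<close> is divisible by the full power of every prime in
  \<open>order G\<close>, hence by \<open>order G\<close> itself.\<close>

lemma subgroup_containing_sylows:
  assumes fin: "finite (carrier G)" and K: "subgroup K G"
    and P: "\<And>p. prime p \<Longrightarrow> \<exists>P. sylow_subgroup p P G \<and> P \<subseteq> K"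
  shows "K = carrier G"
proof -
  have pos: "card K > 0" using K fin by (simp add: subgroup.finite_imp_card_positive)
  have "order G dvd card K"
  proof (rule multiplicity_le_imp_dvd)
    show "order G \<noteq> 0" using fin order_gt_0_iff_finite by simp
    fix p :: nat assume p: "prime p"
    then obtain P where P: "sylow_subgroup p P G" "P \<subseteq> K" using P by blast
    interpret K: group "G\<lparr>carrier := K\<rparr>" by (rule subgroup_imp_group[OF K])
    have "subgroup P (G\<lparr>carrier := K\<rparr>)"
      using P K subgroup_incl by (auto simp: sylow_subgroup_def)
    then have "subgroup_index (G\<lparr>carrier := K\<rparr>) P * card P = card K"
      using K.index_mult_card[of P] by (simp add: order_def)
    then have "card P dvd card K" by (metis dvd_triv_right)
    then show "multiplicity p (order G) \<le> multiplicity p (card K)"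
      using P pos p by (intro multiplicity_geI) (auto simp: sylow_subgroup_def)
  qed
  then have "order G \<le> card K" using pos by (simp add: dvd_imp_le)
  then show ?thesis
    using card_seteq[OF fin subgroup.subset[OF K]] by (simp add: order_def)
qed

text \<open>Class equation: if the centre were trivial, \<open>{\<one>}\<close> would be the only
  conjugacy class of size prime to \<open>p\<close>, making \<open>order G\<close> congruent to 1
  modulo \<open>p\<close>.\<close>

lemma prime_power_order_center_nontrivial:
  assumes p: "prime p" and ord: "order G = p ^ n" and nt: "carrier G \<noteq> {\<one>}"
  shows "\<exists>z \<in> group_center G. z \<noteq> \<one>"
proof (rule ccontr)
  assume triv: "\<not> ?thesis"
  define \<phi> where "\<phi> = (\<lambda>g. (\<lambda>h \<in> carrier G. g \<otimes> h \<otimes> (inv g)))"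
  interpret A: group_action G "carrier G" \<phi>
    unfolding \<phi>_def by (rule action_by_conjugation)
  let ?O = "orbits G (carrier G) \<phi>"
  have fin: "finite (carrier G)"
    using ord p order_gt_0_iff_finite by (simp add: prime_gt_0_nat)
  have orb1: "orbit G \<phi> \<one> = {\<one>}"
    using one_closed by (auto simp: orbit_def \<phi>_def intro!: exI[of _ \<one>])
  have dvd: "p dvd card (orbit G \<phi> x)" if x: "x \<in> carrier G" and ne: "x \<noteq> \<one>" for x
  proof -
    have "card (orbit G \<phi> x) dvd p ^ n"
      using A.orbit_stabilizer_theorem[OF x] ord by (metis dvd_triv_left)
    then obtain k where k: "card (orbit G \<phi> x) = p ^ k"
      using p by (auto simp: divides_primepow_nat)
    have "k \<noteq> 0"
    proof
      assume "k = 0"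
      then have "card (orbit G \<phi> x) = 1" using k by simp
      \<comment> \<open>An element alone in its conjugacy class commutes with everything, so it is a
        nontrivial central element.\<close>
      then obtain y where y: "orbit G \<phi> x = {y}" by (auto simp: card_1_singleton_iff)
      have conj: "g \<otimes> x \<otimes> inv g = x" if "g \<in> carrier G" for g
      proof -
        have "g \<otimes> x \<otimes> inv g \<in> orbit G \<phi> x" "x \<in> orbit G \<phi> x"
          using that x A.orbit_refl by (auto simp: orbit_def \<phi>_def)
        then show ?thesis using y by simp
      qed
      have "x \<in> group_center G"
        using x conj unfolding group_center_def by (auto intro: inv_solve_right'[THEN iffD1, symmetric])
      then show False using triv ne by blast
    qed
    then show ?thesis using k by simp
  qed
  have finO: "finite ?O" using fin by (simp add: orbits_def)
  \<comment> \<open>Summing the constant 1 over the disjoint orbits counts the group; the class of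
    the identity is then split off.\<close>
  have "(\<Sum>B\<in>?O. \<Sum>x\<in>B. 1) = (\<Sum>x\<in>carrier G. (1::nat))" by (rule A.disjoint_sum[OF fin])
  then have "order G = (\<Sum>B\<in>?O. card B)" by (simp add: order_def)
  also have "\<dots> = card {\<one>} + (\<Sum>B\<in>?O - {{\<one>}}. card B)"
    using orb1 finO by (intro sum.remove) (auto simp: orbits_def)
  finally have "order G = 1 + (\<Sum>B\<in>?O - {{\<one>}}. card B)" by simp
  moreover have "p dvd (\<Sum>B\<in>?O - {{\<one>}}. card B)"
    using dvd orb1 by (intro dvd_sum) (auto simp: orbits_def)
  moreover have "p dvd order G"
  proof -
    have "n \<noteq> 0" using ord nt order_one_triv_iff by (metis power_0)
    then show ?thesis using ord by simp
  qed
  ultimately have "p dvd 1" by (metis dvd_add_left_iff)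
  then show False using p by (simp add: prime_nat_iff)
qed

section \<open>From the power condition to normal, mutually commuting Sylow subgroups\<close>

lemma sylow_normal_if_pow_index_mem:
  assumes fin: "finite (carrier G)" and P: "sylow_subgroup p P G"
    and pow: "\<And>x. x \<in> carrier G \<Longrightarrow> x [^] subgroup_index G P \<in> P"
  shows "P \<lhd> G"
proof -
  have sub: "subgroup P G" and p: "prime p" and card: "card P = p ^ multiplicity p (order G)"
    using P by (auto simp: sylow_subgroup_def)
  have "subgroup_index G P = order G div p ^ multiplicity p (order G)"
    using index_mult_card[OF sub] card p
    by (metis nonzero_mult_div_cancel_right power_not_zero prime_gt_0_nat less_numeral_extra(3))
  \<comment> \<open>The index is what remains of \<open>order G\<close> after removing all factors
    \<open>p\<close>.\<close>
  then have "\<not> p dvd subgroup_index G P"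
    using fin p order_gt_0_iff_finite multiplicity_decompose[of "order G" p]
    by (metis not_gr_zero not_prime_unit)
  then have cop: "coprime (card P) (subgroup_index G P)"
    using p card by (simp add: prime_imp_coprime)
  show ?thesis
  proof (rule normal_invI[OF sub])
    fix g h assume g: "g \<in> carrier G" and h: "h \<in> P"
    have hG: "h \<in> carrier G" using subgroup.mem_carrier[OF sub h] .
    have "(g \<otimes> h \<otimes> inv g) [^] (k::nat) = g \<otimes> h [^] k \<otimes> inv g" for k
    proof (induction k)
      case (Suc k)
      have "inv g \<otimes> (g \<otimes> (h \<otimes> inv g)) = h \<otimes> inv g"
        using g hG by (simp add: m_assoc[symmetric])
      then show ?case using Suc g hG by (simp add: m_assoc)
    qed (use g in simp)
    then have "(g \<otimes> h \<otimes> inv g) [^] card P = \<one>"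
      using g pow_card_subgroup_eq_one[OF sub h] by simp
    \<comment> \<open>Two coprime powers of the conjugate lie in \<open>P\<close>: the one to
      \<open>card P\<close> is trivial, the one to the index is in \<open>P\<close> by
      hypothesis.\<close>
    then show "g \<otimes> h \<otimes> inv g \<in> P"
      using mem_subgroup_if_coprime_pows[OF sub _ _ pow cop] g hG sub
      by (simp add: subgroup.one_closed)
  qed
qed

text \<open>The commutator of \<open>x\<close> and \<open>y\<close> lies in both \<open>P\<close>
  and \<open>Q\<close>, so its order divides two coprime numbers and it is trivial.\<close>

lemma normal_coprime_card_commute:
  assumes P: "P \<lhd> G" and Q: "Q \<lhd> G" and cop: "coprime (card P) (card Q)"
    and x: "x \<in> P" and y: "y \<in> Q"
  shows "x \<otimes> y = y \<otimes> x"
proof -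
  interpret P: normal P G by (rule P)
  interpret Q: normal Q G by (rule Q)
  have xG: "x \<in> carrier G" and yG: "y \<in> carrier G" using x y by auto
  let ?c = "x \<otimes> y \<otimes> inv x \<otimes> inv y"
  \<comment> \<open>Bracketed this way, the commutator is \<open>x\<close> times a conjugate of
    \<open>inv x\<close>; below, it is a conjugate of \<open>y\<close> times
    \<open>inv y\<close>.\<close>
  have "x \<otimes> (y \<otimes> inv x \<otimes> inv y) \<in> P" using x yG P.inv_op_closed2 by simp
  then have cP: "?c \<in> P" using xG yG by (simp add: m_assoc)
  have cQ: "?c \<in> Q" using Q.inv_op_closed2[OF xG y] y by simp
  have "?c \<in> {\<one>}"
    using mem_subgroup_if_coprime_pows[OF triv_subgroup _ _ _ cop, of ?c]
      pow_card_subgroup_eq_one[OF P.subgroup_axioms cP]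
      pow_card_subgroup_eq_one[OF Q.subgroup_axioms cQ] xG yG by simp
  then have "x \<otimes> y \<otimes> inv x = y"
    using xG yG by (simp add: inv_equality[symmetric] inv_solve_right')
  then show ?thesis using xG yG by (simp add: inv_solve_right')
qed

section \<open>Growth of the upper central series\<close>

text \<open>The set is the preimage in \<open>G\<close> of the centralizer of \<open>N #> x\<close>
  in \<open>G Mod N\<close>.\<close>

lemma commuting_mod_normal_subgroup:
  assumes "N \<lhd> G" and xG: "x \<in> carrier G"
  shows "subgroup {g \<in> carrier G. N #> (x \<otimes> g) = N #> (g \<otimes> x)} G" (is "subgroup ?C G")
proof -
  interpret N: normal N G by (rule assms(1))
  show ?thesis
  proof (rule subgroupI)
    show "?C \<noteq> {}" using xG by blast
  next
    fix a assume a: "a \<in> ?C"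
    then have aG: "a \<in> carrier G" by simp
    have "inv a \<otimes> (a \<otimes> x) = x" using aG xG by (simp add: m_assoc[symmetric])
    then have "N #> (x \<otimes> inv a) = (N #> inv a) <#> (N #> (a \<otimes> x)) <#> (N #> inv a)"
      using aG xG by (simp add: N.rcos_sum)
    also have "\<dots> = (N #> inv a) <#> (N #> (x \<otimes> a)) <#> (N #> inv a)"
      using a by simp
    also have "\<dots> = N #> (inv a \<otimes> x)"
      using aG xG by (simp add: N.rcos_sum m_assoc)
    finally show "inv a \<in> ?C" using aG by simp
  next
    fix a b assume a: "a \<in> ?C" and b: "b \<in> ?C"
    then have aG: "a \<in> carrier G" and bG: "b \<in> carrier G" by simp_all
    have "N #> (x \<otimes> (a \<otimes> b)) = (N #> (x \<otimes> a)) <#> (N #> b)"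
      using aG bG xG by (simp add: N.rcos_sum m_assoc)
    also have "\<dots> = (N #> (a \<otimes> x)) <#> (N #> b)" using a by simp
    also have "\<dots> = (N #> a) <#> (N #> (x \<otimes> b))"
      using aG bG xG by (simp add: N.rcos_sum m_assoc)
    also have "\<dots> = (N #> a) <#> (N #> (b \<otimes> x))" using b by simp
    also have "\<dots> = N #> (a \<otimes> b \<otimes> x)"
      using aG bG xG by (simp add: N.rcos_sum m_assoc)
    finally show "a \<otimes> b \<in> ?C" using aG bG by simp
  qed blast
qed

lemma sylows_normal_center_FactGroup_nontrivial:
  assumes fin: "finite (carrier G)" and N: "N \<lhd> G" and ne: "N \<noteq> carrier G"
    and normal: "\<And>p P. sylow_subgroup p P G \<Longrightarrow> P \<lhd> G"
  shows "\<exists>x \<in> carrier G - N. N #> x \<in> group_center (G Mod N)"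
proof -
  interpret N: normal N G by (rule N)
  interpret Q: group "G Mod N" by (rule N.factorgroup_is_group)
  have hom: "group_hom G (G Mod N) (\<lambda>x. N #> x)"
    using N.r_coset_hom_Mod by unfold_locales
  \<comment> \<open>A proper subgroup cannot contain a Sylow subgroup for every prime.\<close>
  obtain p P where p: "prime p" and P: "sylow_subgroup p P G" and PN: "\<not> P \<subseteq> N"
    using subgroup_containing_sylows[OF fin N.subgroup_axioms] sylow_subgroup_exists[OF fin] ne
    by blast
  have subP: "subgroup P G" and cardP: "card P = p ^ multiplicity p (order G)"
    using P by (auto simp: sylow_subgroup_def)
  have PG: "P \<subseteq> carrier G" using subP by (rule subgroup.subset)
  define R where "R = (\<lambda>x. N #> x) ` P"
  have R: "subgroup R (G Mod N)" unfolding R_def by (rule group_hom.subgroup_img_is_subgroup[OF hom subP])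
  interpret R: group "(G Mod N)\<lparr>carrier := R\<rparr>" by (rule Q.subgroup_imp_group[OF R])
  \<comment> \<open>The first isomorphism theorem for the map from \<open>P\<close> onto
    \<open>R\<close>, which makes \<open>R\<close> a \<open>p\<close>-group.\<close>
  have "card R dvd card P"
  proof -
    interpret P: group "G\<lparr>carrier := P\<rparr>" by (rule subgroup_imp_group[OF subP])
    interpret k: group_hom "G\<lparr>carrier := P\<rparr>" "(G Mod N)\<lparr>carrier := R\<rparr>" "\<lambda>x. N #> x"
      unfolding R_def by (rule group_hom.induced_group_hom[OF hom subP])
    let ?K = "kernel (G\<lparr>carrier := P\<rparr>) ((G Mod N)\<lparr>carrier := R\<rparr>) (\<lambda>x. N #> x)"
    have "(\<lambda>X. the_elem ((\<lambda>x. N #> x) ` X)) \<in> iso ((G\<lparr>carrier := P\<rparr>) Mod ?K) ((G Mod N)\<lparr>carrier := R\<rparr>)"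
      by (rule k.FactGroup_iso_set) (simp add: R_def)
    then have "card (carrier ((G\<lparr>carrier := P\<rparr>) Mod ?K)) = card R"
      by (auto simp: iso_def dest: bij_betw_same_card)
    then have "card R * card ?K = card P"
      using P.lagrange[OF k.subgroup_kernel] by (simp add: FactGroup_def order_def)
    then show ?thesis by (metis dvd_triv_left)
  qed
  then obtain n where n: "card R = p ^ n"
    using p cardP by (auto simp: divides_primepow_nat)
  obtain y where y: "y \<in> P" "y \<notin> N" using PN by blast
  have yR: "N #> y \<in> R" "N #> y \<noteq> N"
    using y PG rcos_self[OF _ N.subgroup_axioms] by (auto simp: R_def)
  have "\<exists>z \<in> group_center ((G Mod N)\<lparr>carrier := R\<rparr>). z \<noteq> \<one>\<^bsub>(G Mod N)\<lparr>carrier := R\<rparr>\<^esub>"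
    by (rule R.prime_power_order_center_nontrivial[OF p, of n]) (use n yR in \<open>auto simp: order_def\<close>)
  then obtain z where z: "z \<in> R" "z \<noteq> N" "\<And>w. w \<in> R \<Longrightarrow> z <#> w = w <#> z"
    by (auto simp: group_center_def)
  then obtain x where x: "x \<in> P" "z = N #> x" unfolding R_def by blast
  have xG: "x \<in> carrier G" using x PG by blast
  have xN: "x \<notin> N" using x z N.rcos_const[OF is_group] by blast
  let ?C = "{g \<in> carrier G. N #> (x \<otimes> g) = N #> (g \<otimes> x)}"
  have C: "subgroup ?C G" by (rule commuting_mod_normal_subgroup[OF N xG])
  \<comment> \<open>For \<open>q = p\<close> the subgroup \<open>P\<close> itself serves, because
    \<open>z\<close> is central in \<open>R\<close>. For any other \<open>q\<close>, a Sylow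
    \<open>q\<close>-subgroup commutes with \<open>x\<close> already in \<open>G\<close>, the orders
    being coprime.\<close>
  have "?C = carrier G"
  proof (rule subgroup_containing_sylows[OF fin C])
    fix q :: nat assume q: "prime q"
    show "\<exists>P. sylow_subgroup q P G \<and> P \<subseteq> ?C"
    proof (cases "q = p")
      case True
      have "P \<subseteq> ?C"
      proof
        fix g assume g: "g \<in> P"
        then have "(N #> x) <#> (N #> g) = (N #> g) <#> (N #> x)"
          using z(3)[of "N #> g"] x by (simp add: R_def)
        then show "g \<in> ?C" using g PG xG by (auto simp: N.rcos_sum)
      qed
      then show ?thesis using P True by blast
    next
      case False
      obtain S where S: "sylow_subgroup q S G" using sylow_subgroup_exists[OF fin q] by blast
      have "coprime (card P) (card S)"
        using S cardP p q False by (simp add: sylow_subgroup_def primes_coprime)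
      then have "x \<otimes> g = g \<otimes> x" if "g \<in> S" for g
        using normal_coprime_card_commute[OF normal[OF P] normal[OF S] _ x(1) that] by simp
      moreover have "S \<subseteq> carrier G" using S by (simp add: sylow_subgroup_def subgroup.subset)
      ultimately show ?thesis using S by auto
    qed
  qed
  then have "N #> x \<in> group_center (G Mod N)"
    using xG by (auto simp: group_center_def carrier_FactGroup N.rcos_sum)
  then show ?thesis using xG xN by blast
qed

lemma sylows_normal_imp_nilpotent:
  assumes fin: "finite (carrier G)" and normal: "\<And>p P. sylow_subgroup p P G \<Longrightarrow> P \<lhd> G"
  shows "nilpotent_group G"
proof (rule ccontr)
  assume "\<not> ?thesis"
  then have ne: "upper_central_series G i \<noteq> carrier G" for i
    by (auto simp: nilpotent_group_def)
  have sub: "upper_central_series G i \<subseteq> carrier G" for i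
    using upper_central_series_normal normal_imp_subgroup subgroup.subset by blast
  have "upper_central_series G i \<subset> upper_central_series G (Suc i)" for i
  proof -
    have "\<exists>x \<in> carrier G - upper_central_series G i.
        upper_central_series G i #> x \<in> group_center (G Mod upper_central_series G i)"
      by (rule sylows_normal_center_FactGroup_nontrivial[OF fin upper_central_series_normal ne])
        (rule normal)
    then obtain x where "x \<in> carrier G - upper_central_series G i"
      "upper_central_series G i #> x \<in> group_center (G Mod upper_central_series G i)"
      by (rule bexE)
    then have "x \<in> upper_central_series G (Suc i) - upper_central_series G i" by simp
    then show ?thesis using upper_central_series_mono[of i] by blast
  qed
  then have less: "card (upper_central_series G i) < card (upper_central_series G (Suc i))" for i
    using sub fin by (meson psubset_card_mono finite_subset)
  \<comment> \<open>Strict growth adds at least one element per step, which is absurd at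
    \<open>Suc (order G)\<close>.\<close>
  have "i \<le> card (upper_central_series G i)" for i
  proof (induction i)
    case (Suc i)
    then show ?case using less[of i] by linarith
  qed simp
  moreover have "card (upper_central_series G i) \<le> order G" for i
    using sub fin by (simp add: order_def card_mono)
  ultimately have "Suc (order G) \<le> order G" using le_trans by blast
  then show False by simp
qed

end

theorem theorem5:
  fixes G :: "('a, 'b) monoid_scheme" (structure)
  assumes "group G" and "finite (carrier G)"
  shows "(nilpotent_group G
            \<longleftrightarrow> (\<forall>H. subgroup H G \<longrightarrow> (\<forall>x \<in> carrier G. x [^] subgroup_index G H \<in> H)))
       \<and> (nilpotent_group G
            \<longleftrightarrow> (\<forall>p P. sylow_subgroup p P G \<longrightarrow> (\<forall>x \<in> carrier G. x [^] subgroup_index G P \<in> P)))"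
    (is "(?nil \<longleftrightarrow> ?all) \<and> (?nil \<longleftrightarrow> ?sylow)")
proof -
  interpret group G by (rule assms(1))
  have "?nil \<Longrightarrow> ?all" using nilpotent_imp_pow_index_mem[OF _ assms(2)] by blast
  moreover have "?all \<Longrightarrow> ?sylow" by (auto simp: sylow_subgroup_def)
  moreover have "?sylow \<Longrightarrow> ?nil"
    using sylows_normal_imp_nilpotent[OF assms(2)] sylow_normal_if_pow_index_mem[OF assms(2)] by blast
  ultimately show ?thesis by blast
qed

end
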